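(* For all compositions $\alpha,\beta$, $$\left\langle \mathbf{H}_\alpha^q,\mathbf{H}_\beta^q\right\rangle = (-1)^{|\alpha|+\ell(\alpha)}\,\delta_{\alpha\,\beta^c},$$ where $\mathbf{H}_\alpha^q=\sum_{\beta\ge\alpha} q^{c(\alpha,\beta^c)}\,\mathbf{s}_\beta$ (sum over compositions $\beta$ of $|\alpha|$ with $\beta\geq\alpha$).
   Context: A composition $\alpha$ of a positive integer $n$ ($\alpha\models n$) is a sequence $(\alpha_1,\dots,\alpha_\ell)$ of positive integers with sum $n$; $|\alpha|=n$, $\ell(\alpha)=\ell$. Its descent set is $D(\alpha)=\{\alpha_1,\alpha_1+\alpha_2,\dots,\alpha_1+\cdots+\alpha_{\ell-1}\}\subseteq\{1,\dots,n-1\}$; the map $\alpha\mapsto D(\alpha)$ is a bijection from compositions of $n$ to subsets of $\{1,\dots,n-1\}$. For compositions of the same $n$, $\alpha\le\beta$ (equivalently $\beta\geq\alpha$; $\alpha$ is finer) means $D(\beta)\subseteq D(\alpha)$. The composition $\alpha^c$ of $n$ is defined by $D(\alpha^c)=\{1,\dots,n-1\}\setminus D(\alpha)$. For $\alpha,\beta\models n$, $c(\alpha,\beta)=\sum_{i\in D(\alpha)\cap D(\beta)} i$. $NC\Lambda$ (non-commutative symmetric functions) is the free associative algebra on $\mathbf{h}_1,\mathbf{h}_2,\dots$ over $\mathbb{Q}$, with coefficients extended to $\mathbb{Q}(q)$, graded by $\deg \mathbf{h}_k=k$. Put $\mathbf{h}_\alpha=\mathbf{h}_{\alpha_1}\cdots\mathbf{h}_{\alpha_\ell}$.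 The ribbon Schur functions $\mathbf{s}_\alpha=\sum_{\beta\ge\alpha}(-1)^{\ell(\alpha)-\ell(\beta)}\mathbf{h}_\beta$, $\alpha\models n$, form a basis of the degree $n$ part. The scalar product on $NC\Lambda$ is the bilinear form with $\langle \mathbf{s}_\alpha,\mathbf{s}_\beta\rangle=(-1)^{|\alpha|+\ell(\alpha)}\delta_{\alpha\,\beta^c}$ (in particular it is $0$ if $|\alpha|\ne|\beta|$). *)

theory Defs
  imports
    Complex_Main
    "HOL-Library.Poly_Mapping"
    "HOL-Computational_Algebra.Polynomial"
    "HOL-Computational_Algebra.Fraction_Field"
begin

section \<open>Compositions\<close>

text \<open>The empty list is included, as the only composition of \<open>0\<close>: it is the unit for
  concatenation and indexes the basis element \<open>1\<close> of the free algebra.\<close>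

typedef composition = "{xs :: nat list. 0 \<notin> set xs}"
  morphisms parts Abs_composition
  by (rule exI[of _ "[]"]) simp

setup_lifting type_definition_composition

instantiation composition :: monoid_add
begin

lift_definition zero_composition :: composition is "[]" by simp

lift_definition plus_composition :: "composition \<Rightarrow> composition \<Rightarrow> composition" is "(@)" by simp

instance by standard (transfer; simp)+

end

definition weight :: "composition \<Rightarrow> nat" where
  "weight \<alpha> = sum_list (parts \<alpha>)"

definition len :: "composition \<Rightarrow> nat" where
  "len \<alpha> = length (parts \<alpha>)"

definition descents :: "composition \<Rightarrow> nat set" where
  "descents \<alpha> = {sum_list (take i (parts \<alpha>)) | i. 1 \<le> i \<and> i < len \<alpha>}"

lemma finite_descents [simp]: "finite (descents \<alpha>)"
  unfolding descents_def by simp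

lemma sum_list_take_strict:
  assumes "0 \<notin> set (xs :: nat list)" "i < j" "j \<le> length xs"
  shows "sum_list (take i xs) < sum_list (take j xs)"
proof -
  have "take j xs = take i xs @ take (j - i) (drop i xs)"
    using assms by (metis le_add_diff_inverse less_imp_le_nat take_add)
  moreover obtain y ys where *: "take (j - i) (drop i xs) = y # ys"
    using assms by (cases "take (j - i) (drop i xs)") auto
  moreover have "y \<in> set xs"
    using * by (metis in_set_dropD in_set_takeD list.set_intros(1))
  ultimately show ?thesis using assms(1) by (cases y) auto
qed

lemma zero_notin_parts [simp]: "0 \<notin> set (parts \<alpha>)"
  using parts[of \<alpha>] by simp

lemma card_descents: "card (descents \<alpha>) = len \<alpha> - 1"
proof -
  have "inj_on (\<lambda>i. sum_list (take i (parts \<alpha>))) {1..<len \<alpha>}"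
    unfolding inj_on_def len_def
    by (metis atLeastLessThan_iff less_imp_le_nat linorder_neqE_nat nat_neq_iff
        sum_list_take_strict zero_notin_parts)
  moreover have "descents \<alpha> = (\<lambda>i. sum_list (take i (parts \<alpha>))) ` {1..<len \<alpha>}"
    unfolding descents_def by auto
  ultimately show ?thesis by (simp add: card_image)
qed

lemma descents_subset: "descents \<alpha> \<subseteq> {1..<weight \<alpha>}"
proof
  fix x assume "x \<in> descents \<alpha>"
  then obtain i where i: "x = sum_list (take i (parts \<alpha>))" "1 \<le> i" "i < length (parts \<alpha>)"
    unfolding descents_def len_def by auto
  show "x \<in> {1..<weight \<alpha>}"
    using sum_list_take_strict[of "parts \<alpha>" 0 i]
      sum_list_take_strict[of "parts \<alpha>" i "length (parts \<alpha>)"] i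
    by (simp add: weight_def)
qed

lemma descents_snoc:
  assumes "0 \<notin> set xs" "xs \<noteq> []" "0 < k"
  shows "descents (Abs_composition (xs @ [k])) =
    insert (sum_list xs) (descents (Abs_composition xs))"
proof -
  have p: "parts (Abs_composition (xs @ [k])) = xs @ [k]" "parts (Abs_composition xs) = xs"
    using assms by (auto simp: Abs_composition_inverse)
  show ?thesis
  proof (intro set_eqI iffI)
    fix x assume "x \<in> descents (Abs_composition (xs @ [k]))"
    then obtain i where "x = sum_list (take i (xs @ [k]))" "1 \<le> i" "i \<le> length xs"
      unfolding descents_def len_def p by auto
    then show "x \<in> insert (sum_list xs) (descents (Abs_composition xs))"
      unfolding descents_def len_def p by (cases "i = length xs") auto
  next
    fix x assume "x \<in> insert (sum_list xs) (descents (Abs_composition xs))"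
    then consider "x = sum_list xs" | i where "x = sum_list (take i xs)" "1 \<le> i" "i < length xs"
      unfolding descents_def len_def p by auto
    then show "x \<in> descents (Abs_composition (xs @ [k]))"
    proof cases
      case 1
      moreover have "1 \<le> length xs" using assms(2) by (cases xs) auto
      ultimately show ?thesis
        unfolding descents_def len_def p by (auto intro!: exI[of _ "length xs"])
    next
      case 2
      then show ?thesis
        unfolding descents_def len_def p by (auto intro!: exI[of _ i])
    qed
  qed
qed

lemma ex_composition:
  "0 < n \<Longrightarrow> S \<subseteq> {1..<n} \<Longrightarrow> \<exists>\<alpha>. weight \<alpha> = n \<and> descents \<alpha> = S"
proof (induction n arbitrary: S rule: less_induct)
  case (less n)
  show ?case
  proof (cases "S = {}")
    case True
    have "parts (Abs_composition [n]) = [n]"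
      using less.prems by (simp add: Abs_composition_inverse)
    then show ?thesis using True
      by (intro exI[of _ "Abs_composition [n]"]) (auto simp: weight_def descents_def len_def)
  next
    case False
    have fin: "finite S" using less.prems(2) finite_subset by blast
    define m where "m = Max S"
    have m: "m \<in> S" using fin False unfolding m_def by simp
    then have m': "0 < m" "m < n" using less.prems(2) by auto
    have "S - {m} \<subseteq> {1..<m}"
    proof
      fix x assume x: "x \<in> S - {m}"
      then have "x \<le> m" using fin unfolding m_def by simp
      then show "x \<in> {1..<m}" using x less.prems(2) by auto
    qed
    then obtain \<alpha> where \<alpha>: "weight \<alpha> = m" "descents \<alpha> = S - {m}"
      using less.IH m' by blast
    have ne: "parts \<alpha> \<noteq> []" using \<alpha>(1) m' by (auto simp: weight_def)
    have "descents (Abs_composition (parts \<alpha> @ [n - m])) = S"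
      using descents_snoc[OF zero_notin_parts ne, of "n - m"] m m' \<alpha>
      by (auto simp: parts_inverse weight_def)
    moreover have "weight (Abs_composition (parts \<alpha> @ [n - m])) = n"
      using \<alpha>(1) m' by (simp add: weight_def Abs_composition_inverse)
    ultimately show ?thesis by blast
  qed
qed

lemma descents_inj_aux:
  "\<lbrakk>0 \<notin> set xs; 0 \<notin> set ys; sum_list xs = sum_list ys;
    descents (Abs_composition xs) = descents (Abs_composition ys)\<rbrakk> \<Longrightarrow> xs = ys"
proof (induction xs arbitrary: ys rule: rev_induct)
  case Nil
  then show ?case by (cases ys) auto
next
  case (snoc k xs)
  have k: "0 < k" "0 \<notin> set xs" using snoc.prems by auto
  obtain zs l where ys: "ys = zs @ [l]"
    using snoc.prems(1,3) by (cases ys rule: rev_cases) auto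
  have l: "0 < l" "0 \<notin> set zs" using snoc.prems ys by auto
  have single: "descents (Abs_composition [j]) = {}" if "0 < j" for j
    using that by (auto simp: descents_def len_def Abs_composition_inverse)
  have less: "x < sum_list us" if "0 \<notin> set us" "x \<in> descents (Abs_composition us)" for x us
    using that descents_subset[of "Abs_composition us"]
    by (auto simp: weight_def Abs_composition_inverse)
  show ?case
  proof (cases "xs = [] \<or> zs = []")
    case True
    have "xs = [] \<and> zs = []"
      using True snoc.prems(4) single k l ys descents_snoc[of xs k] descents_snoc[of zs l]
      by (cases "xs = []"; cases "zs = []") auto
    then show ?thesis using snoc.prems(3) ys by simp
  next
    case False
    have eq: "insert (sum_list xs) (descents (Abs_composition xs)) =
      insert (sum_list zs) (descents (Abs_composition zs))"
      using snoc.prems(4) False k l ys descents_snoc[of xs k] descents_snoc[of zs l] by auto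
    then have sums: "sum_list xs = sum_list zs"
      by (metis insertE insertI1 k(2) l(2) less less_asym)
    have "sum_list xs \<notin> descents (Abs_composition xs)"
      "sum_list zs \<notin> descents (Abs_composition zs)"
      using less k l by blast+
    then have "descents (Abs_composition xs) = descents (Abs_composition zs)"
      using eq sums by (metis insert_ident)
    then have "xs = zs" using snoc.IH k l sums by blast
    then show ?thesis using sums snoc.prems(3) ys by simp
  qed
qed

lemma descents_inj: "weight \<alpha> = weight \<beta> \<Longrightarrow> descents \<alpha> = descents \<beta> \<Longrightarrow> \<alpha> = \<beta>"
  using descents_inj_aux[of "parts \<alpha>" "parts \<beta>"]
  by (simp add: weight_def parts_inverse parts_inject)

lemma bij_betw_descents: "bij_betw descents {\<alpha>. weight \<alpha> = n} (Pow {1..<n})"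
proof (rule bij_betw_imageI)
  show "inj_on descents {\<alpha>. weight \<alpha> = n}"
    by (auto intro!: inj_onI descents_inj)
  have "S \<in> descents ` {\<alpha>. weight \<alpha> = n}" if "S \<subseteq> {1..<n}" for S
  proof (cases "n = 0")
    case True
    then show ?thesis using that
      by (intro image_eqI[of _ _ "0 :: composition"])
        (auto simp: descents_def weight_def len_def zero_composition.rep_eq)
  next
    case False
    then show ?thesis using ex_composition[OF _ that] by blast
  qed
  moreover have "descents ` {\<alpha>. weight \<alpha> = n} \<subseteq> Pow {1..<n}"
    using descents_subset by blast
  ultimately show "descents ` {\<alpha>. weight \<alpha> = n} = Pow {1..<n}" by blast
qed

lemma finite_compositions [simp]: "finite {\<alpha>. weight \<alpha> = n}"
  using bij_betw_finite[OF bij_betw_descents, of n] by simp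

text \<open>\<open>\<alpha> \<le> \<beta>\<close> means that \<open>\<alpha>\<close> is finer than \<open>\<beta>\<close>.\<close>

instantiation composition :: order
begin

definition less_eq_composition :: "composition \<Rightarrow> composition \<Rightarrow> bool" where
  "\<alpha> \<le> \<beta> \<longleftrightarrow> weight \<alpha> = weight \<beta> \<and> descents \<beta> \<subseteq> descents \<alpha>"

definition less_composition :: "composition \<Rightarrow> composition \<Rightarrow> bool" where
  "\<alpha> < \<beta> \<longleftrightarrow> \<alpha> \<le> \<beta> \<and> \<not> \<beta> \<le> (\<alpha> :: composition)"

instance
  by standard
    (auto simp: less_eq_composition_def less_composition_def intro: descents_inj)

end

lemma finite_coarser [simp]: "finite {\<beta> :: composition. \<alpha> \<le> \<beta>}"
  by (rule finite_subset[OF _ finite_compositions[of "weight \<alpha>"]])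
    (auto simp: less_eq_composition_def)

definition complement :: "composition \<Rightarrow> composition" where
  "complement \<alpha> =
    (THE \<gamma>. weight \<gamma> = weight \<alpha> \<and> descents \<gamma> = {1..<weight \<alpha>} - descents \<alpha>)"

lemma weight_complement [simp]: "weight (complement \<alpha>) = weight \<alpha>" (is ?A)
  and descents_complement: "descents (complement \<alpha>) = {1..<weight \<alpha>} - descents \<alpha>" (is ?B)
proof -
  have "\<exists>\<gamma>. weight \<gamma> = weight \<alpha> \<and> descents \<gamma> = {1..<weight \<alpha>} - descents \<alpha>"
  proof -
    have "{1..<weight \<alpha>} - descents \<alpha> \<in> descents ` {\<gamma>. weight \<gamma> = weight \<alpha>}"
      unfolding bij_betw_imp_surj_on[OF bij_betw_descents] by blast
    then show ?thesis by force
  qed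
  then have "\<exists>!\<gamma>. weight \<gamma> = weight \<alpha> \<and> descents \<gamma> = {1..<weight \<alpha>} - descents \<alpha>"
    by (auto intro: descents_inj)
  from theI'[OF this] show ?A ?B unfolding complement_def by auto
qed

definition cstat :: "composition \<Rightarrow> composition \<Rightarrow> nat" where
  "cstat \<alpha> \<beta> = \<Sum> (descents \<alpha> \<inter> descents \<beta>)"


section \<open>Non-commutative symmetric functions\<close>

type_synonym ratfun = "rat poly fract"

definition qvar :: ratfun where
  "qvar = Fraction_Field.Fract [:0, 1:] 1"

text \<open>Compositions under concatenation are the free monoid on the positive integers, so the
  free associative algebra on \<open>h\<^sub>1, h\<^sub>2, \<dots>\<close> is its monoid algebra: the finitely supported
  functions on compositions with the convolution product of \<^theory>\<open>HOL-Library.Poly_Mapping\<close>.\<close>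

type_synonym ncsym = "composition \<Rightarrow>\<^sub>0 ratfun"

definition scale :: "ratfun \<Rightarrow> ncsym \<Rightarrow> ncsym" where
  "scale c x = Poly_Mapping.map ((*) c) x"

text \<open>The generator \<open>h\<^sub>k\<close>, for \<open>k \<ge> 1\<close>; the value at \<open>0\<close> is irrelevant.\<close>

definition hgen :: "nat \<Rightarrow> ncsym" where
  "hgen k = Poly_Mapping.single (Abs_composition [k]) 1"

definition hprod :: "composition \<Rightarrow> ncsym" where
  "hprod \<alpha> = prod_list (map hgen (parts \<alpha>))"

text \<open>The natural number subtraction is exact: \<open>\<alpha> \<le> \<beta>\<close> implies \<open>len \<beta> \<le> len \<alpha>\<close>.\<close>

definition ribbon :: "composition \<Rightarrow> ncsym" where
  "ribbon \<alpha> = (\<Sum>\<beta> | \<alpha> \<le> \<beta>. (-1) ^ (len \<alpha> - len \<beta>) * hprod \<beta>)"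

definition bilinear_form :: "(ncsym \<Rightarrow> ncsym \<Rightarrow> ratfun) \<Rightarrow> bool" where
  "bilinear_form B \<longleftrightarrow>
    (\<forall>x. Vector_Spaces.linear scale (*) (\<lambda>y. B x y)) \<and>
    (\<forall>y. Vector_Spaces.linear scale (*) (\<lambda>x. B x y))"

definition is_scalar_product :: "(ncsym \<Rightarrow> ncsym \<Rightarrow> ratfun) \<Rightarrow> bool" where
  "is_scalar_product B \<longleftrightarrow> bilinear_form B \<and>
    (\<forall>\<alpha> \<beta>. B (ribbon \<alpha>) (ribbon \<beta>) =
      (if \<alpha> = complement \<beta> then (-1) ^ (weight \<alpha> + len \<alpha>) else 0))"

text \<open>Existence and uniqueness of the form are \<open>ex1_scalar_product\<close> below.\<close>

definition scalar_product :: "ncsym \<Rightarrow> ncsym \<Rightarrow> ratfun" where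
  "scalar_product = (THE B. is_scalar_product B)"

definition Hq :: "composition \<Rightarrow> ncsym" where
  "Hq \<alpha> = (\<Sum>\<beta> | \<alpha> \<le> \<beta>. scale (qvar ^ cstat \<alpha> (complement \<beta>)) (ribbon \<beta>))"

subsection \<open>The scalar product is well defined\<close>

lemma lookup_scale [simp]: "Poly_Mapping.lookup (scale c x) k = c * Poly_Mapping.lookup x k"
  unfolding scale_def by (simp add: map.rep_eq when_def)

lemma vector_space_scale: "vector_space scale"
  by standard (auto intro!: poly_mapping_eqI simp: lookup_add algebra_simps)

lemma vector_space_ratfun: "vector_space ((*) :: ratfun \<Rightarrow> ratfun \<Rightarrow> ratfun)"
  by standard (auto simp: algebra_simps)

lemma linear_ncsymI:
  assumes "\<And>x y. f (x + y) = f x + f y" "\<And>c x. f (scale c x) = c * f x"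
  shows "Vector_Spaces.linear scale (*) (f :: ncsym \<Rightarrow> ratfun)"
  using vector_space_scale vector_space_ratfun assms
  by (simp add: Vector_Spaces.linear_iff)

lemma len_diff_card:
  assumes "\<alpha> \<le> \<beta>"
  shows "len \<alpha> - len \<beta> = card (descents \<alpha> - descents \<beta>)" and "len \<beta> \<le> len \<alpha>"
proof -
  have pos: "len \<gamma> = 0 \<longleftrightarrow> weight \<gamma> = 0" for \<gamma>
  proof -
    have "parts \<gamma> = [] \<longleftrightarrow> sum_list (parts \<gamma>) = 0"
      using zero_notin_parts[of \<gamma>] by (cases "parts \<gamma>") auto
    then show ?thesis by (simp add: len_def weight_def)
  qed
  have w: "weight \<alpha> = weight \<beta>" and sub: "descents \<beta> \<subseteq> descents \<alpha>"
    using assms by (auto simp: less_eq_composition_def)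
  have c: "card (descents \<beta>) \<le> card (descents \<alpha>)"
    using sub by (simp add: card_mono)
  have d: "card (descents \<alpha> - descents \<beta>) = card (descents \<alpha>) - card (descents \<beta>)"
    using sub by (simp add: card_Diff_subset)
  show "len \<beta> \<le> len \<alpha>" "len \<alpha> - len \<beta> = card (descents \<alpha> - descents \<beta>)"
    using c d pos[of \<alpha>] pos[of \<beta>] w unfolding card_descents by linarith+
qed

lemma moebius_coarsening:
  "(\<Sum>\<beta> | \<alpha> \<le> \<beta> \<and> \<beta> \<le> \<gamma>. (-1) ^ (len \<alpha> - len \<beta>)) =
    (if \<alpha> = \<gamma> then 1 else (0 :: 'a :: comm_ring_1))"
proof (cases "\<alpha> \<le> \<gamma>")
  case False
  then have "{\<beta>. \<alpha> \<le> \<beta> \<and> \<beta> \<le> \<gamma>} = {}" by (auto dest: order_trans)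
  moreover have "\<alpha> \<noteq> \<gamma>" using False by auto
  ultimately show ?thesis by (simp only: sum.empty if_False)
next
  case True
  then have w: "weight \<gamma> = weight \<alpha>" and sub: "descents \<gamma> \<subseteq> descents \<alpha>"
    by (auto simp: less_eq_composition_def)
  let ?X = "descents \<alpha> - descents \<gamma>"
  have "bij_betw (\<lambda>\<beta>. descents \<alpha> - descents \<beta>) {\<beta>. \<alpha> \<le> \<beta> \<and> \<beta> \<le> \<gamma>} (Pow ?X)"
  proof (rule bij_betw_imageI)
    show "inj_on (\<lambda>\<beta>. descents \<alpha> - descents \<beta>) {\<beta>. \<alpha> \<le> \<beta> \<and> \<beta> \<le> \<gamma>}"
    proof (rule inj_onI)
      fix \<beta> \<delta> assume *: "\<beta> \<in> {\<beta>. \<alpha> \<le> \<beta> \<and> \<beta> \<le> \<gamma>}" "\<delta> \<in> {\<beta>. \<alpha> \<le> \<beta> \<and> \<beta> \<le> \<gamma>}"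
        "descents \<alpha> - descents \<beta> = descents \<alpha> - descents \<delta>"
      have sub: "descents \<beta> \<subseteq> descents \<alpha>" "descents \<delta> \<subseteq> descents \<alpha>"
        using *(1,2) unfolding mem_Collect_eq less_eq_composition_def by blast+
      have "weight \<beta> = weight \<delta>"
        using *(1,2) unfolding mem_Collect_eq less_eq_composition_def by metis
      moreover have "descents \<beta> = descents \<delta>"
        using *(3) sub by (metis double_diff order_refl)
      ultimately show "\<beta> = \<delta>" by (rule descents_inj)
    qed
    have "Y \<in> (\<lambda>\<beta>. descents \<alpha> - descents \<beta>) ` {\<beta>. \<alpha> \<le> \<beta> \<and> \<beta> \<le> \<gamma>}" if Y: "Y \<subseteq> ?X" for Y
    proof -
      have "descents \<alpha> - Y \<in> Pow {1..<weight \<alpha>}"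
        using descents_subset by blast
      then have "descents \<alpha> - Y \<in> descents ` {\<beta>. weight \<beta> = weight \<alpha>}"
        using bij_betw_imp_surj_on[OF bij_betw_descents] by metis
      then obtain \<beta> where \<beta>: "weight \<beta> = weight \<alpha>" "descents \<beta> = descents \<alpha> - Y" by auto
      then have "\<alpha> \<le> \<beta> \<and> \<beta> \<le> \<gamma>" using w sub Y by (auto simp: less_eq_composition_def)
      moreover have "Y = descents \<alpha> - descents \<beta>" using \<beta> Y by auto
      ultimately show ?thesis by blast
    qed
    moreover have "descents \<alpha> - descents \<beta> \<subseteq> ?X" if "\<beta> \<le> \<gamma>" for \<beta>
      using that by (auto simp: less_eq_composition_def)
    ultimately show "(\<lambda>\<beta>. descents \<alpha> - descents \<beta>) ` {\<beta>. \<alpha> \<le> \<beta> \<and> \<beta> \<le> \<gamma>} = Pow ?X"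
      by blast
  qed
  then have bij: "(\<Sum>\<beta> | \<alpha> \<le> \<beta> \<and> \<beta> \<le> \<gamma>. (-1) ^ card (descents \<alpha> - descents \<beta>)) =
      (\<Sum>Y\<in>Pow ?X. (-1) ^ card Y :: 'a)"
    by (rule sum.reindex_bij_betw)
  have "(\<Sum>\<beta> | \<alpha> \<le> \<beta> \<and> \<beta> \<le> \<gamma>. (-1) ^ (len \<alpha> - len \<beta>)) =
      (\<Sum>\<beta> | \<alpha> \<le> \<beta> \<and> \<beta> \<le> \<gamma>. (-1) ^ card (descents \<alpha> - descents \<beta>) :: 'a)"
    by (intro sum.cong refl) (simp only: mem_Collect_eq len_diff_card)
  also note bij
  also have "(\<Sum>Y\<in>Pow ?X. (-1) ^ card Y :: 'a) = (\<Prod>x\<in>?X. 1 - 1)"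
    by (subst prod_diff_conv_sum) simp_all
  also have "\<dots> = 0 ^ card ?X" by simp
  also have "\<dots> = (if \<alpha> = \<gamma> then 1 else 0)"
  proof (cases "\<alpha> = \<gamma>")
    case False
    have "?X \<noteq> {}"
    proof
      assume "?X = {}"
      then have "descents \<alpha> = descents \<gamma>" using sub by (simp add: Diff_eq_empty_iff subset_antisym)
      with False w show False using descents_inj[of \<alpha> \<gamma>] by metis
    qed
    then have "0 < card ?X" by (simp add: card_gt_0_iff)
    then show ?thesis using False by (simp only: zero_power if_False)
  qed simp
  finally show ?thesis .
qed

lemma moebius_coarsening':
  "(\<Sum>\<beta> | \<alpha> \<le> \<beta> \<and> \<beta> \<le> \<gamma>. (-1) ^ (len \<beta> - len \<gamma>)) =
    (if \<alpha> = \<gamma> then 1 else (0 :: 'a :: comm_ring_1))"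
proof -
  have "(-1) ^ (len \<beta> - len \<gamma>) = (-1) ^ (len \<alpha> - len \<gamma>) * ((-1) ^ (len \<alpha> - len \<beta>) :: 'a)"
    if "\<alpha> \<le> \<beta> \<and> \<beta> \<le> \<gamma>" for \<beta>
  proof -
    have "len \<gamma> \<le> len \<beta>" "len \<beta> \<le> len \<alpha>" using that len_diff_card(2) by auto
    then have "(len \<alpha> - len \<gamma>) + (len \<alpha> - len \<beta>) = (len \<beta> - len \<gamma>) + 2 * (len \<alpha> - len \<beta>)"
      by simp
    then show ?thesis by (metis power_add power_minus1_even mult.right_neutral)
  qed
  then have "(\<Sum>\<beta> | \<alpha> \<le> \<beta> \<and> \<beta> \<le> \<gamma>. (-1) ^ (len \<beta> - len \<gamma>)) =
      (-1) ^ (len \<alpha> - len \<gamma>) * (\<Sum>\<beta> | \<alpha> \<le> \<beta> \<and> \<beta> \<le> \<gamma>. (-1) ^ (len \<alpha> - len \<beta>) :: 'a)"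
    by (simp add: sum_distrib_left)
  then show ?thesis unfolding moebius_coarsening by auto
qed

lemma sum_coarser_swap:
  "(\<Sum>\<beta> | \<alpha> \<le> \<beta>. \<Sum>\<gamma> | \<beta> \<le> \<gamma>. f \<beta> \<gamma>) =
    (\<Sum>\<gamma> | \<alpha> \<le> \<gamma>. \<Sum>\<beta> | \<alpha> \<le> \<beta> \<and> \<beta> \<le> \<gamma>. f \<beta> (\<gamma> :: composition) :: 'a :: comm_monoid_add)"
proof -
  have "(\<Sum>\<beta> | \<alpha> \<le> \<beta>. \<Sum>\<gamma> | \<beta> \<le> \<gamma>. f \<beta> \<gamma>) =
      (\<Sum>\<beta> | \<beta> \<in> {\<beta>. \<alpha> \<le> \<beta>}. \<Sum>\<gamma> | \<gamma> \<in> {\<gamma>. \<alpha> \<le> \<gamma>} \<and> \<beta> \<le> \<gamma>. f \<beta> \<gamma>)"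
    by (intro sum.cong) (auto dest: order_trans)
  also have "\<dots> = (\<Sum>\<gamma>\<in>{\<gamma>. \<alpha> \<le> \<gamma>}. \<Sum>\<beta> | \<beta> \<in> {\<beta>. \<alpha> \<le> \<beta>} \<and> \<beta> \<le> \<gamma>. f \<beta> \<gamma>)"
    by (simp only: Collect_mem_eq) (rule sum.swap_restrict; simp)
  finally show ?thesis by simp
qed

lemma hprod_eq_single: "hprod \<alpha> = Poly_Mapping.single \<alpha> 1"
proof -
  have "0 \<notin> set xs \<Longrightarrow> prod_list (map hgen xs) = Poly_Mapping.single (Abs_composition xs) 1" for xs
  proof (induction xs)
    case Nil
    show ?case by (simp flip: zero_composition_def single_one)
  next
    case (Cons k xs)
    then have "Abs_composition [k] + Abs_composition xs = Abs_composition (k # xs)"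
      by (simp add: plus_composition.abs_eq eq_onp_def)
    with Cons show ?case by (simp add: hgen_def mult_single)
  qed
  from this[of "parts \<alpha>"] show ?thesis by (simp add: hprod_def parts_inverse)
qed

lemma ribbon_eq: "ribbon \<alpha> = (\<Sum>\<beta> | \<alpha> \<le> \<beta>. scale ((-1) ^ (len \<alpha> - len \<beta>)) (hprod \<beta>))"
proof -
  have "(-1) ^ k * x = scale ((-1) ^ k) x" for k x
    by (induction k) (auto intro!: poly_mapping_eqI)
  then show ?thesis by (simp add: ribbon_def)
qed

lemma hprod_eq_sum_ribbon: "hprod \<alpha> = (\<Sum>\<beta> | \<alpha> \<le> \<beta>. ribbon \<beta>)"
proof -
  interpret vector_space scale by (rule vector_space_scale)
  have "(\<Sum>\<beta> | \<alpha> \<le> \<beta>. ribbon \<beta>) =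
      (\<Sum>\<gamma> | \<alpha> \<le> \<gamma>. scale (\<Sum>\<beta> | \<alpha> \<le> \<beta> \<and> \<beta> \<le> \<gamma>. (-1) ^ (len \<beta> - len \<gamma>)) (hprod \<gamma>))"
    unfolding ribbon_eq sum_coarser_swap scale_sum_left ..
  also have "\<dots> = (\<Sum>\<gamma> | \<alpha> \<le> \<gamma>. if \<alpha> = \<gamma> then hprod \<gamma> else 0)"
    unfolding moebius_coarsening' by (intro sum.cong) auto
  finally show ?thesis by (simp add: sum.delta)
qed

lemma ncsym_expand:
  "x = (\<Sum>k\<in>Poly_Mapping.keys x. scale (Poly_Mapping.lookup x k) (hprod k))"
  by (rule poly_mapping_eqI)
    (auto simp: lookup_sum hprod_eq_single lookup_single when_def if_distrib in_keys_iff cong: if_cong)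

lemma linear_ext_ribbon:
  assumes f: "Vector_Spaces.linear scale (*) f" and g: "Vector_Spaces.linear scale (*) g"
    and eq: "\<And>\<alpha>. f (ribbon \<alpha>) = (g (ribbon \<alpha>) :: ratfun)"
  shows "f x = g x"
proof -
  interpret f: Vector_Spaces.linear scale "(*)" f by (rule f)
  interpret g: Vector_Spaces.linear scale "(*)" g by (rule g)
  show ?thesis
    by (subst (1 2) ncsym_expand)
      (simp add: f.sum g.sum f.scale g.scale hprod_eq_sum_ribbon eq)
qed

definition lin_ext :: "(composition \<Rightarrow> ratfun) \<Rightarrow> ncsym \<Rightarrow> ratfun" where
  "lin_ext f x = (\<Sum>k\<in>Poly_Mapping.keys x. Poly_Mapping.lookup x k * f k)"

lemma lin_ext_superset:
  "finite K \<Longrightarrow> Poly_Mapping.keys x \<subseteq> K \<Longrightarrow>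
    lin_ext f x = (\<Sum>k\<in>K. Poly_Mapping.lookup x k * f k)"
  unfolding lin_ext_def by (rule sum.mono_neutral_left) (auto simp: in_keys_iff)

lemma lin_ext_add: "lin_ext f (x + y) = lin_ext f x + lin_ext f y"
proof -
  let ?K = "Poly_Mapping.keys x \<union> Poly_Mapping.keys y"
  have "lin_ext f z = (\<Sum>k\<in>?K. Poly_Mapping.lookup z k * f k)" if "z \<in> {x, y, x + y}" for z
    using that Poly_Mapping.keys_add[of x y] by (intro lin_ext_superset) auto
  then show ?thesis by (simp add: lookup_add distrib_right sum.distrib)
qed

lemma lin_ext_scale: "lin_ext f (scale c x) = c * lin_ext f x"
proof -
  have "lin_ext f (scale c x) =
      (\<Sum>k\<in>Poly_Mapping.keys x. Poly_Mapping.lookup (scale c x) k * f k)"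
    by (rule lin_ext_superset) (auto simp: in_keys_iff)
  then show ?thesis by (simp add: lin_ext_def sum_distrib_left mult.assoc)
qed

lemma linear_lin_ext: "Vector_Spaces.linear scale (*) (lin_ext f)"
  by (rule linear_ncsymI) (simp_all add: lin_ext_add lin_ext_scale)

lemma lin_ext_fun_add: "lin_ext (\<lambda>k. f k + g k) x = lin_ext f x + lin_ext g x"
  by (simp add: lin_ext_def distrib_left sum.distrib)

lemma lin_ext_fun_scale: "lin_ext (\<lambda>k. c * f k) x = c * lin_ext f x"
  by (simp add: lin_ext_def sum_distrib_left mult.left_commute)

lemma lin_ext_fun_sum: "lin_ext (\<lambda>k. \<Sum>i\<in>I. f i k) x = (\<Sum>i\<in>I. lin_ext (f i) x)"
  unfolding lin_ext_def sum_distrib_left by (rule sum.swap)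

lemma lin_ext_ribbon: "lin_ext (\<lambda>\<alpha>. \<Sum>\<beta> | \<alpha> \<le> \<beta>. t \<beta>) (ribbon \<alpha>) = t \<alpha>"
proof -
  interpret Vector_Spaces.linear scale "(*)" "lin_ext f" for f by (rule linear_lin_ext)
  have single: "lin_ext f (hprod \<beta>) = f \<beta>" for f \<beta>
    by (simp add: lin_ext_def hprod_eq_single)
  have "lin_ext (\<lambda>\<alpha>. \<Sum>\<beta> | \<alpha> \<le> \<beta>. t \<beta>) (ribbon \<alpha>) =
      (\<Sum>\<gamma> | \<alpha> \<le> \<gamma>. (\<Sum>\<beta> | \<alpha> \<le> \<beta> \<and> \<beta> \<le> \<gamma>. (-1) ^ (len \<alpha> - len \<beta>)) * t \<gamma>)"
    by (simp add: ribbon_eq sum scale single sum_distrib_left sum_distrib_right sum_coarser_swap)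
  also have "\<dots> = (\<Sum>\<gamma> | \<alpha> \<le> \<gamma>. if \<alpha> = \<gamma> then t \<gamma> else 0)"
    unfolding moebius_coarsening by (intro sum.cong) auto
  finally show ?thesis by (simp add: sum.delta)
qed

lemma ex1_scalar_product: "\<exists>!B. is_scalar_product B"
proof (rule ex_ex1I)
  define t :: "composition \<Rightarrow> composition \<Rightarrow> ratfun" where
    "t \<alpha> \<beta> = (if \<alpha> = complement \<beta> then (-1) ^ (weight \<alpha> + len \<alpha>) else 0)" for \<alpha> \<beta>
  define B where "B x y = lin_ext (\<lambda>\<alpha>. lin_ext (\<lambda>\<beta>. \<Sum>\<gamma> | \<alpha> \<le> \<gamma>. \<Sum>\<delta> | \<beta> \<le> \<delta>. t \<gamma> \<delta>) y) x"
    for x y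
  have "Vector_Spaces.linear scale (*) (\<lambda>y. B x y)" for x
    unfolding B_def
    by (rule linear_ncsymI)
      (simp_all add: lin_ext_add lin_ext_scale lin_ext_fun_add lin_ext_fun_scale)
  moreover have "Vector_Spaces.linear scale (*) (\<lambda>x. B x y)" for y
    unfolding B_def by (rule linear_lin_ext)
  moreover have "B (ribbon \<alpha>) (ribbon \<beta>) = t \<alpha> \<beta>" for \<alpha> \<beta>
    by (simp add: B_def lin_ext_fun_sum lin_ext_ribbon)
  ultimately show "\<exists>B. is_scalar_product B"
    unfolding is_scalar_product_def bilinear_form_def t_def by blast
next
  fix B C assume B: "is_scalar_product B" and C: "is_scalar_product C"
  have lin: "Vector_Spaces.linear scale (*) (\<lambda>y. B x y)" "Vector_Spaces.linear scale (*) (\<lambda>x. B x y)"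
    "Vector_Spaces.linear scale (*) (\<lambda>y. C x y)" "Vector_Spaces.linear scale (*) (\<lambda>x. C x y)" for x y
    using B C by (simp_all add: is_scalar_product_def bilinear_form_def)
  have "B (ribbon \<alpha>) (ribbon \<beta>) = C (ribbon \<alpha>) (ribbon \<beta>)" for \<alpha> \<beta>
    using B C by (simp add: is_scalar_product_def)
  then have "B (ribbon \<alpha>) y = C (ribbon \<alpha>) y" for \<alpha> y
    by (rule linear_ext_ribbon[OF lin(1) lin(3)])
  then have "B x y = C x y" for x y
    by (rule linear_ext_ribbon[OF lin(2) lin(4)])
  then show "B = C" by blast
qed

lemma is_scalar_product_scalar_product: "is_scalar_product scalar_product"
  unfolding scalar_product_def by (rule theI'[OF ex1_scalar_product])

end

theory Submission
  imports Defs
begin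

text \<open>Expanding both arguments, only the pairs \<open>(\<gamma>, \<gamma>\<^sup>c)\<close> with
  \<open>\<alpha> \<le> \<gamma> \<le> \<beta>\<^sup>c\<close> contribute. For these, \<open>D(\<alpha>) \<inter> D(\<beta>)\<close> is the disjoint union of
  \<open>D(\<alpha>) \<inter> D(\<gamma>\<^sup>c)\<close> and \<open>D(\<beta>) \<inter> D(\<gamma>)\<close>, so the power of \<open>q\<close> is \<open>c(\<alpha>, \<beta>)\<close>
  independently of \<open>\<gamma>\<close>, and the remaining alternating sum over the interval is the Moebius
  sum, which vanishes unless \<open>\<alpha> = \<beta>\<^sup>c\<close>; in that case \<open>c(\<alpha>, \<beta>) = 0\<close>.\<close>

lemma complement_complement [simp]: "complement (complement \<alpha>) = \<alpha>"
  using descents_subset[of \<alpha>] by (intro descents_inj) (auto simp: descents_complement)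

text \<open>For \<open>n\<close> the common weight, both sides say that the two descent sets
  together cover \<open>{1..<n}\<close>, a symmetric condition.\<close>

lemma le_complement_iff: "\<alpha> \<le> complement \<beta> \<longleftrightarrow> \<beta> \<le> complement \<alpha>"
  using descents_subset[of \<alpha>] descents_subset[of \<beta>]
  by (auto simp: less_eq_composition_def descents_complement)

lemma cstat_complement_add:
  assumes "\<alpha> \<le> \<gamma>" "\<gamma> \<le> complement \<beta>"
  shows "cstat \<alpha> (complement \<gamma>) + cstat \<beta> \<gamma> = cstat \<alpha> \<beta>"
proof -
  have w: "weight \<gamma> = weight \<alpha>" "weight \<beta> = weight \<alpha>"
    and sub: "descents \<gamma> \<subseteq> descents \<alpha>" "{1..<weight \<alpha>} - descents \<beta> \<subseteq> descents \<gamma>"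
    using assms by (auto simp: less_eq_composition_def descents_complement)
  \<comment> \<open>The upper bound on \<open>\<gamma>\<close> puts the descents of
    \<open>complement \<gamma>\<close> inside those of \<open>\<beta>\<close>; the lower bound puts
    those of \<open>\<gamma>\<close> inside those of \<open>\<alpha>\<close>.\<close>
  have "descents \<alpha> \<inter> descents \<beta> =
      (descents \<alpha> \<inter> descents (complement \<gamma>)) \<union> (descents \<beta> \<inter> descents \<gamma>)"
    using sub descents_subset[of \<alpha>] w by (auto simp: descents_complement)
  moreover have "(descents \<alpha> \<inter> descents (complement \<gamma>)) \<inter> (descents \<beta> \<inter> descents \<gamma>) = {}"
    by (auto simp: descents_complement)
  ultimately show ?thesis
    unfolding cstat_def by (simp add: sum.union_disjoint)
qed

lemma cstat_complement [simp]: "cstat (complement \<alpha>) \<alpha> = 0"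
  by (auto simp: cstat_def descents_complement)

lemma scalar_product_ribbon:
  "scalar_product (ribbon \<alpha>) (ribbon \<beta>) =
    (if \<alpha> = complement \<beta> then (-1) ^ (weight \<alpha> + len \<alpha>) else 0)"
  using is_scalar_product_scalar_product by (simp add: is_scalar_product_def)

lemma scalar_product_sum_scale:
  "scalar_product (\<Sum>i\<in>I. scale (a i) (x i)) (\<Sum>j\<in>J. scale (b j) (y j)) =
    (\<Sum>i\<in>I. \<Sum>j\<in>J. a i * (b j * scalar_product (x i) (y j)))"
proof -
  have lin: "Vector_Spaces.linear scale (*) (\<lambda>v. scalar_product u v)"
    "Vector_Spaces.linear scale (*) (\<lambda>v. scalar_product v u)" for u
    using is_scalar_product_scalar_product
    by (simp_all add: is_scalar_product_def bilinear_form_def)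
  interpret l: Vector_Spaces.linear scale "(*)" "\<lambda>v. scalar_product v u" for u by (rule lin)
  interpret r: Vector_Spaces.linear scale "(*)" "\<lambda>v. scalar_product u v" for u by (rule lin)
  show ?thesis
    \<comment> \<open>Expanding the left argument first keeps the sum over \<open>I\<close>
      outermost.\<close>
    by (simp only: l.sum l.scale) (simp add: r.sum r.scale sum_distrib_left)
qed

theorem proposition8:
  fixes \<alpha> \<beta> :: composition
  shows "scalar_product (Hq \<alpha>) (Hq \<beta>) =
    (if \<alpha> = complement \<beta> then (-1) ^ (weight \<alpha> + len \<alpha>) else 0)"
proof -
  let ?I = "{\<gamma>. \<alpha> \<le> \<gamma> \<and> \<gamma> \<le> complement \<beta>}"
  let ?t = "\<lambda>\<gamma>. qvar ^ cstat \<alpha> (complement \<gamma>) * (qvar ^ cstat \<beta> \<gamma> * (-1) ^ (weight \<gamma> + len \<gamma>))"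
  have inner: "(\<Sum>\<delta> | \<beta> \<le> \<delta>. qvar ^ cstat \<alpha> (complement \<gamma>) *
        (qvar ^ cstat \<beta> (complement \<delta>) * scalar_product (ribbon \<gamma>) (ribbon \<delta>))) =
      (if \<gamma> \<le> complement \<beta> then ?t \<gamma> else 0)" for \<gamma>
  proof -
    \<comment> \<open>Solved for the summation variable \<open>\<delta>\<close>, the condition
      collapses the sum to one term, present iff
      \<open>\<beta> \<le> complement \<gamma>\<close>.\<close>
    have iff: "\<gamma> = complement \<delta> \<longleftrightarrow> \<delta> = complement \<gamma>" for \<delta> by auto
    have "(\<Sum>\<delta> | \<beta> \<le> \<delta>. qvar ^ cstat \<alpha> (complement \<gamma>) *
        (qvar ^ cstat \<beta> (complement \<delta>) * scalar_product (ribbon \<gamma>) (ribbon \<delta>))) =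
      (\<Sum>\<delta> | \<beta> \<le> \<delta>. if \<delta> = complement \<gamma> then ?t \<gamma> else 0)"
      by (intro sum.cong) (auto simp: scalar_product_ribbon iff)
    then show ?thesis by (simp add: le_complement_iff[of \<gamma>])
  qed
  have "?t \<gamma> = qvar ^ cstat \<alpha> \<beta> * (-1) ^ (weight \<alpha> + len \<alpha>) * (-1) ^ (len \<alpha> - len \<gamma>)"
    if "\<gamma> \<in> ?I" for \<gamma>
  proof -
    from that have "weight \<gamma> = weight \<alpha>" "len \<gamma> \<le> len \<alpha>"
      by (auto simp: less_eq_composition_def intro: len_diff_card(2))
    \<comment> \<open>The exponents differ by an even number, so the signs agree;
      \<open>len \<gamma> \<le> len \<alpha>\<close> keeps the subtraction exact.\<close>
    then have "(weight \<alpha> + len \<alpha>) + (len \<alpha> - len \<gamma>) = (weight \<gamma> + len \<gamma>) + 2 * (len \<alpha> - len \<gamma>)"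
      by simp
    then have "(-1) ^ (weight \<gamma> + len \<gamma>) =
        (-1) ^ (weight \<alpha> + len \<alpha>) * ((-1) ^ (len \<alpha> - len \<gamma>) :: ratfun)"
      by (metis power_add power_minus1_even mult.right_neutral)
    moreover from that have "cstat \<alpha> \<beta> = cstat \<alpha> (complement \<gamma>) + cstat \<beta> \<gamma>"
      by (simp add: cstat_complement_add)
    ultimately show ?thesis by (simp only: power_add mult.assoc)
  qed
  then have "sum ?t ?I = qvar ^ cstat \<alpha> \<beta> * (-1) ^ (weight \<alpha> + len \<alpha>) *
      (\<Sum>\<gamma>\<in>?I. (-1) ^ (len \<alpha> - len \<gamma>))"
    unfolding sum_distrib_left by (intro sum.cong refl)
  moreover have "scalar_product (Hq \<alpha>) (Hq \<beta>) = sum ?t ?I"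
    unfolding Hq_def scalar_product_sum_scale inner
    by (subst sum.inter_filter[symmetric]) simp_all
  ultimately show ?thesis by (simp add: moebius_coarsening)
qed

end
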